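(* Let $k,n\in\mathbb{N}$ with $n\ge2$. For every $m\in\mathbb{N}_0$ and every $\vec\xi=(\xi_0,\ldots,\xi_{k-1})\in\mathbb{C}^k$ one has $$\mathcal{H}_m(\vec\xi\otimes\vec\zeta_n')=\sum_{j=0}^{[m/n]}(-1)^{m-jn}\,\mathcal{E}_{m-jn}(\vec\xi\,)\,\mathcal{H}_j(\vec\xi^{\,n}).$$ Further: (1) if $m\le(n-1)k$, then $$\mathcal{E}_m(\vec\xi\otimes\vec\zeta_n')=\sum_{j=0}^{[m/n]}(-1)^{m-j}\,\mathcal{H}_{m-jn}(\vec\xi\,)\,\mathcal{E}_j(\vec\xi^{\,n});$$ (2) if $m>(n-1)k$, then $$\sum_{j=0}^{[M/n]}(-1)^{m-j}\,\mathcal{H}_{m-jn}(\vec\xi\,)\,\mathcal{E}_j(\vec\xi^{\,n})=0,$$ where $M:=\min\{m,nk\}$.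
   Context: $\mathbb{N}=\{1,2,\ldots\}$, $\mathbb{N}_0=\mathbb{N}\cup\{0\}$; $[t]$ is the integer part of the real number $t$. $\zeta_n:=e^{2\pi i/n}$ and $\vec\zeta_n':=(\zeta_n,\zeta_n^2,\ldots,\zeta_n^{n-1})\in\mathbb{C}^{n-1}$. For $\vec\xi=(\xi_0,\ldots,\xi_{k-1})\in\mathbb{C}^k$, $\vec\xi^{\,n}:=(\xi_0^n,\ldots,\xi_{k-1}^n)$. The Kronecker product of $\vec x=(x_1,\ldots,x_a)\in\mathbb{C}^a$ and $\vec y=(y_1,\ldots,y_b)\in\mathbb{C}^b$ is $\vec x\otimes\vec y=(x_1\vec y,\ldots,x_a\vec y)\in\mathbb{C}^{ab}$, where $x_j\vec y=(x_jy_1,\ldots,x_jy_b)$. For $\vec z=(z_1,\ldots,z_r)\in\mathbb{C}^r$, the elementary symmetric polynomials are $\mathcal{E}_0(\vec z):=1$, $\mathcal{E}_m(\vec z):=\sum_{1\le j_1<\cdots<j_m\le r}z_{j_1}\cdots z_{j_m}$ for $1\le m\le r$, $\mathcal{E}_m(\vec z):=0$ for $m>r$; the complete homogeneous symmetric polynomials are $\mathcal{H}_0(\vec z):=1$ and $\mathcal{H}_m(\vec z):=\sum_{1\le j_1\le\cdots\le j_m\le r}z_{j_1}\cdots z_{j_m}$ for $m\ge1$. *)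

theory Defs
  imports Complex_Main
begin

text \<open>
  A vector in \<open>\<complex>\<^sup>r\<close> is a \<^typ>\<open>complex list\<close> of length \<open>r\<close>, with entries indexed from \<open>0\<close>.
\<close>

definition zeta :: "nat \<Rightarrow> complex" where
  "zeta n = exp (2 * of_real pi * \<i> / of_nat n)"

definition zeta_vec' :: "nat \<Rightarrow> complex list" where
  "zeta_vec' n = map (\<lambda>j. zeta n ^ j) [1..<n]"

definition vec_power :: "complex list \<Rightarrow> nat \<Rightarrow> complex list" where
  "vec_power x n = map (\<lambda>a. a ^ n) x"

definition kronecker :: "complex list \<Rightarrow> complex list \<Rightarrow> complex list"  (infixr \<open>\<otimes>\<^sub>K\<close> 70) where
  "x \<otimes>\<^sub>K y = concat (map (\<lambda>a. map (\<lambda>b. a * b) y) x)"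

text \<open>
  The lists \<open>js\<close> below are the index tuples \<open>(j\<^sub>1, \<dots>, j\<^sub>m)\<close>, strictly increasing for the
  elementary and weakly increasing for the complete homogeneous symmetric polynomials.
  The only tuple for \<open>m = 0\<close> is the empty one, and there is no strictly increasing
  one for \<open>m > r\<close>; the usual conventions for these cases are therefore lemmas.
\<close>

definition elem_sym :: "nat \<Rightarrow> complex list \<Rightarrow> complex" where
  "elem_sym m z =
     (\<Sum>js | length js = m \<and> set js \<subseteq> {..<length z} \<and> sorted_wrt (<) js. \<Prod>j\<leftarrow>js. z ! j)"

definition complete_sym :: "nat \<Rightarrow> complex list \<Rightarrow> complex" where
  "complete_sym m z =
     (\<Sum>js | length js = m \<and> set js \<subseteq> {..<length z} \<and> sorted_wrt (\<le>) js. \<Prod>j\<leftarrow>js. z ! j)"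

lemma finite_index_tuples:
  "finite {js :: nat list. length js = m \<and> set js \<subseteq> {..<r} \<and> P js}"
  by (rule finite_subset[OF _ finite_lists_length_eq[of "{..<r}" m]]) auto

lemma elem_sym_0: "elem_sym 0 z = 1"
proof -
  have "{js. length js = 0 \<and> set js \<subseteq> {..<length z} \<and> sorted_wrt (<) js} = {[]}"
    by auto
  then show ?thesis by (simp add: elem_sym_def)
qed

lemma complete_sym_0: "complete_sym 0 z = 1"
proof -
  have "{js. length js = 0 \<and> set js \<subseteq> {..<length z} \<and> sorted_wrt (\<le>) js} = {[]}"
    by auto
  then show ?thesis by (simp add: complete_sym_def)
qed

lemma elem_sym_gt:
  assumes "m > length z"
  shows "elem_sym m z = 0"
proof -
  have "length js \<le> length z" if "set js \<subseteq> {..<length z}" "sorted_wrt (<) js" for js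
  proof -
    have "length js = card (set js)"
      using that(2) by (simp add: strict_sorted_iff distinct_card)
    also have "\<dots> \<le> length z"
      using card_mono[OF _ that(1)] by simp
    finally show ?thesis .
  qed
  with assms have empty:
    "{js. length js = m \<and> set js \<subseteq> {..<length z} \<and> sorted_wrt (<) js} = {}"
    by fastforce
  show ?thesis
    unfolding elem_sym_def empty by simp
qed

end

theory Submission
  imports Defs "HOL-Computational_Algebra.Polynomial_FPS" "HOL-Computational_Algebra.Formal_Laurent_Series"
begin

text \<open>
  In generating functions, \<open>\<Sum>\<^sub>m (-1)\<^sup>m \<E>\<^sub>m(z) X\<^sup>m = \<Prod>\<^sub>i (1 - z\<^sub>i X)\<close> is the inverse of
  \<open>\<Sum>\<^sub>m \<H>\<^sub>m(z) X\<^sup>m\<close>. Since \<open>\<Prod>\<^sub>j\<^sub><\<^sub>n (1 - \<xi> \<zeta>\<^sub>n\<^sup>j X) = 1 - \<xi>\<^sup>n X\<^sup>n\<close>, where the factor \<open>j = 0\<close>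
  belongs to \<open>\<xi>\<close> itself and the others to \<open>\<xi> \<otimes> \<zeta>'\<^sub>n\<close>, the product of the polynomials of
  \<open>\<xi>\<close> and \<open>\<xi> \<otimes> \<zeta>'\<^sub>n\<close> is that of \<open>\<xi>\<^sup>n\<close> in the variable \<open>X\<^sup>n\<close>. All three claims compare
  coefficients in this identity, solved for one factor or its inverse.
\<close>

section \<open>Recursions for symmetric polynomials from index tuples\<close>

definition index_tuples :: "(nat \<Rightarrow> nat \<Rightarrow> bool) \<Rightarrow> nat \<Rightarrow> nat \<Rightarrow> nat list set" where
  "index_tuples R m r = {js. length js = m \<and> set js \<subseteq> {..<r} \<and> sorted_wrt R js}"

lemma index_tuples_finite: "finite (index_tuples R m r)"
  unfolding index_tuples_def by (rule finite_index_tuples)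

lemma pos_list_eq_map_Suc:
  assumes "0 \<notin> set js"
  shows "js = map Suc (map (\<lambda>j. j - 1) js)"
  using assms by (induction js) auto

lemma map_Suc_in_index_tuples_iff:
  assumes "\<And>i j. R (Suc i) (Suc j) \<longleftrightarrow> R i j"
  shows "map Suc js \<in> index_tuples R m (Suc r) \<longleftrightarrow> js \<in> index_tuples R m r"
  using assms by (auto simp: index_tuples_def sorted_wrt_map)

text \<open>Case split on the first entry. After a leading 0 another 0 may follow, so the tail still
  ranges over all \<open>Suc r\<close> indices; if the first entry is positive, so are all others,
  and the tuple is a shift.\<close>

lemma index_tuples_le_Suc:
  "index_tuples (\<le>) (Suc m) (Suc r) =
     (#) 0 ` index_tuples (\<le>) m (Suc r) \<union> map Suc ` index_tuples (\<le>) (Suc m) r"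
proof (intro equalityI subsetI)
  fix js assume js: "js \<in> index_tuples (\<le>) (Suc m) (Suc r)"
  then obtain i l where i: "js = i # l"
    by (auto simp: index_tuples_def length_Suc_conv)
  show "js \<in> (#) 0 ` index_tuples (\<le>) m (Suc r) \<union> map Suc ` index_tuples (\<le>) (Suc m) r"
  proof (cases "i = 0")
    case True
    with js i show ?thesis by (auto simp: index_tuples_def)
  next
    case False
    with js i have "0 \<notin> set js" by (auto simp: index_tuples_def)
    then obtain js' where "js = map Suc js'" using pos_list_eq_map_Suc by blast
    with js show ?thesis by (auto simp: map_Suc_in_index_tuples_iff)
  qed
next
  fix js assume "js \<in> (#) 0 ` index_tuples (\<le>) m (Suc r) \<union> map Suc ` index_tuples (\<le>) (Suc m) r"
  then show "js \<in> index_tuples (\<le>) (Suc m) (Suc r)"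
    by (auto simp: map_Suc_in_index_tuples_iff) (auto simp: index_tuples_def)
qed

text \<open>Strictness forbids a second 0, so here the tail behind a leading 0 is shifted as
  well.\<close>

lemma index_tuples_less_Suc:
  "index_tuples (<) (Suc m) (Suc r) =
     (\<lambda>js. 0 # map Suc js) ` index_tuples (<) m r \<union> map Suc ` index_tuples (<) (Suc m) r"
proof (intro equalityI subsetI)
  fix js assume js: "js \<in> index_tuples (<) (Suc m) (Suc r)"
  then obtain i l where i: "js = i # l"
    by (auto simp: index_tuples_def length_Suc_conv)
  with js have "0 \<notin> set l" by (auto simp: index_tuples_def)
  then obtain l' where l': "l = map Suc l'" using pos_list_eq_map_Suc by blast
  show "js \<in> (\<lambda>js. 0 # map Suc js) ` index_tuples (<) m r \<union> map Suc ` index_tuples (<) (Suc m) r"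
  proof (cases "i = 0")
    case True
    have "l \<in> index_tuples (<) m (Suc r)" using js i by (auto simp: index_tuples_def)
    with True i l' show ?thesis by (auto simp: map_Suc_in_index_tuples_iff)
  next
    case False
    with i l' have "js = map Suc ((i - 1) # l')" by simp
    with js show ?thesis by (metis UnI2 Suc_less_eq imageI map_Suc_in_index_tuples_iff)
  qed
next
  fix js assume "js \<in> (\<lambda>js. 0 # map Suc js) ` index_tuples (<) m r \<union>
    map Suc ` index_tuples (<) (Suc m) r"
  then show "js \<in> index_tuples (<) (Suc m) (Suc r)"
    by (auto simp: map_Suc_in_index_tuples_iff) (auto simp: index_tuples_def sorted_wrt_map)
qed

text \<open>A leading index 0 contributes the factor \<open>x\<close>, and shifted tuples see only
  \<open>z\<close>. Since \<open>x\<close> may be repeated, \<open>x # z\<close> remains on the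
  right; in generating functions this is multiplication by 1 - x X.\<close>

lemma complete_sym_Cons:
  "complete_sym (Suc m) (x # z) = complete_sym (Suc m) z + x * complete_sym m (x # z)"
proof -
  let ?f = "\<lambda>js. \<Prod>j\<leftarrow>js. (x # z) ! j"
  have "complete_sym (Suc m) (x # z) =
      sum ?f ((#) 0 ` index_tuples (\<le>) m (Suc (length z))) +
      sum ?f (map Suc ` index_tuples (\<le>) (Suc m) (length z))"
    unfolding complete_sym_def index_tuples_def [symmetric] length_Cons index_tuples_le_Suc
    by (rule sum.union_disjoint) (auto simp: index_tuples_finite)
  also have "sum ?f ((#) 0 ` index_tuples (\<le>) m (Suc (length z))) = x * complete_sym m (x # z)"
    unfolding complete_sym_def index_tuples_def [symmetric]
    by (subst sum.reindex) (auto simp: sum_distrib_left)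
  also have "sum ?f (map Suc ` index_tuples (\<le>) (Suc m) (length z)) = complete_sym (Suc m) z"
    unfolding complete_sym_def index_tuples_def [symmetric]
    by (subst sum.reindex) (auto simp: inj_on_def comp_def)
  finally show ?thesis by simp
qed

lemma elem_sym_Cons:
  "elem_sym (Suc m) (x # z) = elem_sym (Suc m) z + x * elem_sym m z"
proof -
  let ?f = "\<lambda>js. \<Prod>j\<leftarrow>js. (x # z) ! j"
  have "elem_sym (Suc m) (x # z) =
      sum ?f ((\<lambda>js. 0 # map Suc js) ` index_tuples (<) m (length z)) +
      sum ?f (map Suc ` index_tuples (<) (Suc m) (length z))"
    unfolding elem_sym_def index_tuples_def [symmetric] length_Cons index_tuples_less_Suc
    by (rule sum.union_disjoint) (auto simp: index_tuples_finite)
  also have "sum ?f ((\<lambda>js. 0 # map Suc js) ` index_tuples (<) m (length z)) = x * elem_sym m z"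
    unfolding elem_sym_def index_tuples_def [symmetric]
    by (subst sum.reindex) (auto simp: sum_distrib_left inj_on_def comp_def)
  also have "sum ?f (map Suc ` index_tuples (<) (Suc m) (length z)) = elem_sym (Suc m) z"
    unfolding elem_sym_def index_tuples_def [symmetric]
    by (subst sum.reindex) (auto simp: inj_on_def comp_def)
  finally show ?thesis by simp
qed

lemma complete_sym_Nil: "complete_sym (Suc m) [] = 0"
proof -
  have "index_tuples (\<le>) (Suc m) 0 = {}" by (auto simp: index_tuples_def)
  then show ?thesis by (simp add: complete_sym_def index_tuples_def)
qed

section \<open>Generating functions as formal power series\<close>

definition linear_prod :: "complex list \<Rightarrow> complex fps" where
  "linear_prod z = (\<Prod>x\<leftarrow>z. 1 - fps_const x * fps_X)"

definition complete_fps :: "complex list \<Rightarrow> complex fps" where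
  "complete_fps z = Abs_fps (\<lambda>m. complete_sym m z)"

lemma linear_prod_simps [simp]:
  "linear_prod [] = 1"
  "linear_prod (x # z) = (1 - fps_const x * fps_X) * linear_prod z"
  "linear_prod (y @ z) = linear_prod y * linear_prod z"
  by (simp_all add: linear_prod_def)

lemma linear_factor_mult_nth:
  fixes f :: "complex fps"
  shows "((1 - fps_const x * fps_X) * f) $ m = f $ m - (if m = 0 then 0 else x * f $ (m - 1))"
  by (simp add: left_diff_distrib mult.assoc)

text \<open>A linear factor acts on coefficients as in \<open>elem_sym_Cons\<close>, with the sign
  absorbed into (-1)^m.\<close>

lemma linear_prod_nth: "linear_prod z $ m = (-1) ^ m * elem_sym m z"
proof (induction z arbitrary: m)
  case Nil
  then show ?case by (cases m) (auto simp: elem_sym_0 elem_sym_gt)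
next
  case (Cons x z)
  then show ?case
    by (cases m) (simp_all add: linear_factor_mult_nth elem_sym_0 elem_sym_Cons algebra_simps)
qed

text \<open>The two series are built up in parallel: by \<open>complete_sym_Cons\<close>, the linear
  factor of a new entry \<open>x\<close> turns \<open>complete_fps (x # z)\<close> back into
  \<open>complete_fps z\<close>.\<close>

lemma complete_fps_mult_linear_prod: "complete_fps z * linear_prod z = 1"
proof (induction z)
  case Nil
  have "complete_fps [] = 1"
  proof (rule fps_ext)
    show "complete_fps [] $ m = 1 $ m" for m
      by (cases m) (simp_all add: complete_fps_def complete_sym_0 complete_sym_Nil)
  qed
  then show ?case by simp
next
  case (Cons x z)
  have "(1 - fps_const x * fps_X) * complete_fps (x # z) = complete_fps z"
  proof (rule fps_ext)
    show "((1 - fps_const x * fps_X) * complete_fps (x # z)) $ m = complete_fps z $ m" for m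
      unfolding linear_factor_mult_nth
      by (cases m) (simp_all add: complete_fps_def complete_sym_0 complete_sym_Cons)
  qed
  with Cons.IH show ?case by (simp add: mult_ac)
qed

section \<open>Roots of unity\<close>

lemma zeta_power: "zeta n ^ j = cis (2 * pi * real j / real n)"
  by (simp add: zeta_def cis_conv_exp flip: exp_of_nat_mult) (simp add: field_simps)

text \<open>For nonzero \<open>w\<close> this is the factorisation of X^n - 1 over its roots,
  evaluated at 1/w and multiplied by w^n.\<close>

lemma prod_one_minus_zeta_power:
  assumes "n > 0"
  shows "(\<Prod>j<n. 1 - w * zeta n ^ j) = 1 - w ^ n"
proof (cases "w = 0")
  case True
  with assms show ?thesis by simp
next
  case False
  define p where "p = (\<Prod>j<n. [:- (zeta n ^ j), 1:])"
  have bij: "bij_betw (\<lambda>j. zeta n ^ j) {..<n} {z. z ^ n = 1}"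
    using bij_betw_roots_unity[OF assms] by (simp add: zeta_power)
  have deg_p: "degree p = n"
    by (simp add: p_def degree_prod_eq_sum_degree)
  have lead_p: "lead_coeff p = 1"
    unfolding p_def lead_coeff_prod by simp
  have "p = monom 1 n - 1"
  \<comment> \<open>Both polynomials are monic of degree \<open>n\<close> and vanish at the
    \<open>n\<close> roots of unity, so their difference has lower degree but \<open>n\<close>
    zeros.\<close>
  proof (rule poly_eqI_degree_lead_coeff[where n = n and A = "{z. z ^ n = 1}"])
    show "coeff p n = coeff (monom 1 n - 1) n" using assms deg_p lead_p by simp
    show "card {z::complex. z ^ n = 1} \<ge> n" using card_roots_unity_eq[OF assms] by simp
    show "degree (monom 1 n - 1 :: complex poly) \<le> n"
      by (rule degree_diff_le) (simp_all add: degree_monom_le)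
    show "poly p z = poly (monom 1 n - 1) z" if "z \<in> {z. z ^ n = 1}" for z
    proof -
      obtain j where "j < n" "z = zeta n ^ j"
        using \<open>z \<in> _\<close> bij by (auto simp: bij_betw_def)
      with that show ?thesis by (auto simp: p_def poly_prod poly_monom)
    qed
  qed (simp add: deg_p)
  then have "poly p (inverse w) = inverse w ^ n - 1"
    by (simp add: poly_monom)
  then have *: "(\<Prod>j<n. inverse w - zeta n ^ j) = inverse w ^ n - 1"
    by (simp add: p_def poly_prod)
  have "(\<Prod>j<n. 1 - w * zeta n ^ j) = (\<Prod>j<n. w * (inverse w - zeta n ^ j))"
    using False by (simp add: right_diff_distrib)
  also have "\<dots> = w ^ n * (inverse w ^ n - 1)"
    by (simp add: prod.distrib *)
  also have "\<dots> = 1 - w ^ n"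
    using False by (simp add: right_diff_distrib flip: power_mult_distrib)
  finally show ?thesis .
qed

lemma linear_prod_zeta:
  assumes "n > 0"
  shows "(1 - fps_const a * fps_X) * linear_prod (map (\<lambda>b. a * b) (zeta_vec' n)) =
    1 - fps_const (a ^ n) * fps_X ^ n"
proof -
  have "(\<Prod>j<n. [:1, - (a * zeta n ^ j):]) = 1 - monom (a ^ n) n"
  \<comment> \<open>The preceding lemma at w = a x, for every \<open>x\<close>, yields an identity
    of polynomials, which then transfers to power series.\<close>
  proof (rule poly_ext)
    fix x
    show "poly (\<Prod>j<n. [:1, - (a * zeta n ^ j):]) x = poly (1 - monom (a ^ n) n) x"
      using prod_one_minus_zeta_power[OF assms, of "a * x"]
      by (simp add: poly_prod poly_monom power_mult_distrib mult_ac)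
  qed
  from arg_cong[OF this, of fps_of_poly]
  have "(\<Prod>j<n. 1 - fps_const (a * zeta n ^ j) * fps_X) = 1 - fps_const (a ^ n) * fps_X ^ n"
    by (simp add: fps_of_poly_prod fps_of_poly_linear' fps_of_poly_diff fps_of_poly_monom flip: fps_const_neg)
  moreover have "(\<Prod>j<n. 1 - fps_const (a * zeta n ^ j) * fps_X) =
      (1 - fps_const a * fps_X) * linear_prod (map (\<lambda>b. a * b) (zeta_vec' n))"
    \<comment> \<open>The factor with j = 0 is split off; the remaining range is that of
      \<open>zeta_vec'\<close>.\<close>
    using assms
    by (simp add: linear_prod_def zeta_vec'_def comp_def lessThan_atLeast0 prod.atLeast_Suc_lessThan
        flip: prod.distinct_set_conv_list)
  ultimately show ?thesis by simp
qed

section \<open>The product identity and its solved forms\<close>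

text \<open>Each entry \<open>a\<close> of \<xi> pairs its own linear factor with its block in the
  Kronecker product; together they give the linear factor of \<open>a ^ n\<close> in the variable
  X^n.\<close>

lemma linear_prod_kronecker:
  assumes "n > 0"
  shows "linear_prod \<xi> * linear_prod (\<xi> \<otimes>\<^sub>K zeta_vec' n) = linear_prod (vec_power \<xi> n) oo fps_X ^ n"
proof (induction \<xi>)
  case Nil
  then show ?case by (simp add: kronecker_def vec_power_def)
next
  case (Cons a \<xi>)
  have "linear_prod (a # \<xi>) * linear_prod ((a # \<xi>) \<otimes>\<^sub>K zeta_vec' n) =
      ((1 - fps_const a * fps_X) * linear_prod (map (\<lambda>b. a * b) (zeta_vec' n))) *
      (linear_prod \<xi> * linear_prod (\<xi> \<otimes>\<^sub>K zeta_vec' n))"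
    by (simp add: kronecker_def mult.assoc mult.left_commute)
  also have "\<dots> = (1 - fps_const (a ^ n) * fps_X ^ n) * (linear_prod (vec_power \<xi> n) oo fps_X ^ n)"
    by (simp only: linear_prod_zeta[OF assms] Cons.IH)
  also have "1 - fps_const (a ^ n) * fps_X ^ n = (1 - fps_const (a ^ n) * fps_X) oo fps_X ^ n"
    \<comment> \<open>Positivity of \<open>n\<close> makes the constant term of
      \<open>fps_X ^ n\<close> zero, so that composition respects products.\<close>
    using assms by (simp add: fps_compose_sub_distrib fps_compose_mult_distrib)
  also have "\<dots> * (linear_prod (vec_power \<xi> n) oo fps_X ^ n) =
      linear_prod (vec_power (a # \<xi>) n) oo fps_X ^ n"
    using assms by (simp add: vec_power_def fps_compose_mult_distrib)
  finally show ?case .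
qed

lemma linear_prod_kronecker_eq:
  assumes "n > 0"
  shows "linear_prod (\<xi> \<otimes>\<^sub>K zeta_vec' n) =
    complete_fps \<xi> * (linear_prod (vec_power \<xi> n) oo fps_X ^ n)"
proof -
  have "complete_fps \<xi> * (linear_prod (vec_power \<xi> n) oo fps_X ^ n) =
      (complete_fps \<xi> * linear_prod \<xi>) * linear_prod (\<xi> \<otimes>\<^sub>K zeta_vec' n)"
    by (simp add: mult.assoc flip: linear_prod_kronecker[OF assms])
  then show ?thesis by (simp add: complete_fps_mult_linear_prod)
qed

lemma complete_fps_kronecker_eq:
  assumes "n > 0"
  shows "complete_fps (\<xi> \<otimes>\<^sub>K zeta_vec' n) =
    linear_prod \<xi> * (complete_fps (vec_power \<xi> n) oo fps_X ^ n)"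
proof -
  let ?K = "\<xi> \<otimes>\<^sub>K zeta_vec' n" and ?C = "complete_fps (vec_power \<xi> n) oo fps_X ^ n"
  have "?C * (linear_prod (vec_power \<xi> n) oo fps_X ^ n) = 1"
    using assms by (simp add: complete_fps_mult_linear_prod flip: fps_compose_mult_distrib)
  \<comment> \<open>A factor 1 is inserted, written so that \<open>linear_prod ?K\<close> appears
    and cancels against \<open>complete_fps ?K\<close>.\<close>
  then have "complete_fps ?K = complete_fps ?K * (?C * (linear_prod \<xi> * linear_prod ?K))"
    by (simp add: linear_prod_kronecker[OF assms])
  also have "\<dots> = (complete_fps ?K * linear_prod ?K) * (linear_prod \<xi> * ?C)"
    by (simp add: mult_ac)
  finally show ?thesis by (simp add: complete_fps_mult_linear_prod)
qed

section \<open>Comparison of coefficients\<close>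

text \<open>In the Cauchy product only the exponents i = j n survive, since g(X^n) has no other
  terms.\<close>

lemma mult_compose_fps_X_power_nth:
  fixes f g :: "'a :: comm_ring_1 fps"
  assumes "n > 0"
  shows "(f * (g oo fps_X ^ n)) $ m = (\<Sum>j=0..m div n. f $ (m - j * n) * g $ j)"
proof -
  have "(f * (g oo fps_X ^ n)) $ m =
      (\<Sum>i=0..m. f $ (m - i) * (if n dvd i then g $ (i div n) else 0))"
    by (subst mult.commute) (simp add: fps_mult_nth fps_nth_compose_X_power mult.commute[of "f $ _"])
  also have "\<dots> = (\<Sum>i\<in>(\<lambda>j. j * n) ` {0..m div n}. f $ (m - i) * (if n dvd i then g $ (i div n) else 0))"
  proof (rule sum.mono_neutral_right)
    show "(\<lambda>j. j * n) ` {0..m div n} \<subseteq> {0..m}"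
      using assms by (auto simp: less_eq_div_iff_mult_less_eq)
    show "\<forall>i\<in>{0..m} - (\<lambda>j. j * n) ` {0..m div n}.
        f $ (m - i) * (if n dvd i then g $ (i div n) else 0) = 0"
    proof
      fix i assume i: "i \<in> {0..m} - (\<lambda>j. j * n) ` {0..m div n}"
      have "\<not> n dvd i"
      proof
        assume "n dvd i"
        then have "i = i div n * n" by simp
        moreover have "i div n \<in> {0..m div n}" using i by (simp add: div_le_mono)
        ultimately show False using i by blast
      qed
      then show "f $ (m - i) * (if n dvd i then g $ (i div n) else 0) = 0" by simp
    qed
  qed simp
  also have "\<dots> = (\<Sum>j=0..m div n. f $ (m - j * n) * g $ j)"
    using assms by (subst sum.reindex) (auto simp: inj_on_def)
  finally show ?thesis .
qed

lemma length_kronecker: "length (x \<otimes>\<^sub>K y) = length x * length y"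
  by (induction x) (simp_all add: kronecker_def)

lemma complete_sym_kronecker_zeta:
  assumes "n > 0"
  shows "complete_sym m (\<xi> \<otimes>\<^sub>K zeta_vec' n) =
    (\<Sum>j=0..m div n. (-1) ^ (m - j * n) * elem_sym (m - j * n) \<xi> * complete_sym j (vec_power \<xi> n))"
proof -
  have "complete_sym m (\<xi> \<otimes>\<^sub>K zeta_vec' n) = complete_fps (\<xi> \<otimes>\<^sub>K zeta_vec' n) $ m"
    by (simp add: complete_fps_def)
  also have "\<dots> = (\<Sum>j=0..m div n. linear_prod \<xi> $ (m - j * n) * complete_fps (vec_power \<xi> n) $ j)"
    by (simp only: complete_fps_kronecker_eq[OF assms] mult_compose_fps_X_power_nth[OF assms])
  finally show ?thesis by (simp add: linear_prod_nth complete_fps_def)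
qed

text \<open>The sign (-1)^m of the left coefficient is its own inverse, and moved to the right it
  merges with (-1)^j. The identity serves both the formula for small \<open>m\<close> and the
  vanishing claim.\<close>

lemma elem_sym_kronecker_zeta:
  assumes "n > 0"
  shows "elem_sym m (\<xi> \<otimes>\<^sub>K zeta_vec' n) =
    (\<Sum>j=0..m div n. (-1) ^ (m - j) * complete_sym (m - j * n) \<xi> * elem_sym j (vec_power \<xi> n))"
proof -
  have "(-1) ^ m * elem_sym m (\<xi> \<otimes>\<^sub>K zeta_vec' n) = linear_prod (\<xi> \<otimes>\<^sub>K zeta_vec' n) $ m"
    by (simp add: linear_prod_nth)
  also have "\<dots> = (\<Sum>j=0..m div n. complete_fps \<xi> $ (m - j * n) * linear_prod (vec_power \<xi> n) $ j)"
    by (simp only: linear_prod_kronecker_eq[OF assms] mult_compose_fps_X_power_nth[OF assms])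
  finally have eq: "(-1) ^ m * elem_sym m (\<xi> \<otimes>\<^sub>K zeta_vec' n) =
      (\<Sum>j=0..m div n. complete_sym (m - j * n) \<xi> * ((-1) ^ j * elem_sym j (vec_power \<xi> n)))"
    by (simp add: linear_prod_nth complete_fps_def)
  have "elem_sym m (\<xi> \<otimes>\<^sub>K zeta_vec' n) = (-1) ^ m * ((-1) ^ m * elem_sym m (\<xi> \<otimes>\<^sub>K zeta_vec' n))"
    by (simp add: minus_one_power_iff)
  also have "\<dots> = (-1) ^ m *
      (\<Sum>j=0..m div n. complete_sym (m - j * n) \<xi> * ((-1) ^ j * elem_sym j (vec_power \<xi> n)))"
    by (simp only: eq)
  also have "\<dots> = (\<Sum>j=0..m div n. (-1) ^ (m - j) * complete_sym (m - j * n) \<xi> * elem_sym j (vec_power \<xi> n))"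
    unfolding sum_distrib_left
  proof (rule sum.cong)
    fix j assume "j \<in> {0..m div n}"
    \<comment> \<open>The exponent \<open>m - j\<close> is a truncated difference, so the sign rule
      requires this bound.\<close>
    then have "j \<le> m" by (meson atLeastAtMost_iff div_le_dividend le_trans)
    then have "(-1 :: complex) ^ (m - j) = (-1) ^ m * (-1) ^ j"
      by (simp add: minus_one_power_iff)
    then show "(-1) ^ m * (complete_sym (m - j * n) \<xi> * ((-1) ^ j * elem_sym j (vec_power \<xi> n))) =
        (-1) ^ (m - j) * complete_sym (m - j * n) \<xi> * elem_sym j (vec_power \<xi> n)"
      by simp
  qed simp
  finally show ?thesis .
qed

theorem corollary1p7:
  fixes k n m :: nat and \<xi> :: "complex list"
  assumes "k \<ge> 1" and "n \<ge> 2" and "length \<xi> = k"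
  shows
    "complete_sym m (\<xi> \<otimes>\<^sub>K zeta_vec' n) =
       (\<Sum>j=0..m div n. (-1) ^ (m - j * n) * elem_sym (m - j * n) \<xi> * complete_sym j (vec_power \<xi> n))
     \<and> (m \<le> (n - 1) * k \<longrightarrow>
          elem_sym m (\<xi> \<otimes>\<^sub>K zeta_vec' n) =
            (\<Sum>j=0..m div n. (-1) ^ (m - j) * complete_sym (m - j * n) \<xi> * elem_sym j (vec_power \<xi> n)))
     \<and> (m > (n - 1) * k \<longrightarrow>
          (\<Sum>j=0..min m (n * k) div n. (-1) ^ (m - j) * complete_sym (m - j * n) \<xi> * elem_sym j (vec_power \<xi> n)) = 0)"
proof (intro conjI impI)
  have n: "n > 0" using assms(2) by simp
  show "complete_sym m (\<xi> \<otimes>\<^sub>K zeta_vec' n) =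
      (\<Sum>j=0..m div n. (-1) ^ (m - j * n) * elem_sym (m - j * n) \<xi> * complete_sym j (vec_power \<xi> n))"
    by (rule complete_sym_kronecker_zeta[OF n])
  show "elem_sym m (\<xi> \<otimes>\<^sub>K zeta_vec' n) =
      (\<Sum>j=0..m div n. (-1) ^ (m - j) * complete_sym (m - j * n) \<xi> * elem_sym j (vec_power \<xi> n))"
    by (rule elem_sym_kronecker_zeta[OF n])
  show "(\<Sum>j=0..min m (n * k) div n.
      (-1) ^ (m - j) * complete_sym (m - j * n) \<xi> * elem_sym j (vec_power \<xi> n)) = 0"
    if "m > (n - 1) * k"
  proof -
    have "(\<Sum>j=0..min m (n * k) div n.
        (-1) ^ (m - j) * complete_sym (m - j * n) \<xi> * elem_sym j (vec_power \<xi> n)) =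
      (\<Sum>j=0..m div n. (-1) ^ (m - j) * complete_sym (m - j * n) \<xi> * elem_sym j (vec_power \<xi> n))"
    proof (rule sum.mono_neutral_left)
      show "\<forall>j\<in>{0..m div n} - {0..min m (n * k) div n}.
          (-1) ^ (m - j) * complete_sym (m - j * n) \<xi> * elem_sym j (vec_power \<xi> n) = 0"
      proof
        fix j assume "j \<in> {0..m div n} - {0..min m (n * k) div n}"
        \<comment> \<open>Such a \<open>j\<close> exists only if n k < m; the upper limit is then (n
          k) div n = k, the length of \<open>vec_power \<xi> n\<close>.\<close>
        then have "j > k" using n by (auto simp: min_def split: if_splits)
        then have "elem_sym j (vec_power \<xi> n) = 0"
          using assms(3) by (intro elem_sym_gt) (simp add: vec_power_def)
        then show "(-1) ^ (m - j) * complete_sym (m - j * n) \<xi> * elem_sym j (vec_power \<xi> n) = 0"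
          by simp
      qed
    qed (auto intro: order_trans[OF _ div_le_mono])
    also have "\<dots> = elem_sym m (\<xi> \<otimes>\<^sub>K zeta_vec' n)"
      by (rule elem_sym_kronecker_zeta[OF n, symmetric])
    \<comment> \<open>The Kronecker product has only (n - 1) k entries, fewer than
      \<open>m\<close>.\<close>
    also have "\<dots> = 0"
      using that assms(3) by (intro elem_sym_gt) (simp add: length_kronecker zeta_vec'_def mult.commute)
    finally show ?thesis .
  qed
qed

end
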